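(* Let $G = (V,E)$ be a connected finite digraph (loops and parallel edges permitted) and let $T \subseteq U \subseteq V$ be such that $|T|$ is even and $|U| \neq 1$. Assume further that every nonempty proper subset $V' \subsetneq V$ with $V' \cap U = \emptyset$ satisfies $d(V') \ge 2$, where $d(V')$ is the number of edges of $G$ with exactly one end in $V'$. Then there exist functions $\phi_2 : E \rightarrow \mathbb{Z}_2$ and $\phi_3 : E \rightarrow \mathbb{Z}_3$ such that all of the following hold: \begin{itemize} \item $(\phi_2(e), \phi_3(e)) \neq (0,0)$ for every $e \in E$, \item $\mathrm{supp}(\partial \phi_2) = T$, and \item $\mathrm{supp}(\partial \phi_3) = U$. \end{itemize}
   Context: Digraphs are finite and may have loops and parallel edges. Connectedness of a digraph refers to its underlying undirected graph. We write $\mathbb{Z}_k = \mathbb{Z}/k\mathbb{Z}$. For a vertex $v$ of a digraph $G=(V,E)$, $\delta^+(v)$ denotes the set of edges with tail $v$ and $\delta^-(v)$ the set of edges with head $v$ (a loop at $v$ belongs to both). For an additive abelian group $\Gamma$ and a function $\phi : E \rightarrow \Gamma$, the boundary of $\phi$ is the function $\partial \phi : V \rightarrow \Gamma$ given by \[ \partial \phi(v) = \sum_{e \in \delta^+(v)} \phi(e) - \sum_{e \in \delta^-(v)} \phi(e). \] For a function $f : V \rightarrow \Gamma$, $\mathrm{supp}(f) = \{ v \in V : f(v) \neq 0 \}$ is its support. For $X \subseteq V$, $d(X)$ denotes the number of edges (regardless of direction) with exactly one end in $X$. *)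

theory Defs
  imports "Graph_Theory.Digraph_Component" "HOL-Library.Numeral_Type"
begin

text \<open>
  A finite digraph, with loops and parallel edges allowed, is a \<^locale>\<open>fin_digraph\<close>.
  The groups $\mathbb{Z}_2$ and $\mathbb{Z}_3$ are the numeral types \<^typ>\<open>2\<close> and
  \<^typ>\<open>3\<close>, whose ring operations are arithmetic modulo 2 and 3.
  Functions on edges or vertices are total functions on the underlying type; only their values
  on \<^const>\<open>arcs\<close> and \<^const>\<open>verts\<close> matter.
\<close>

definition boundary :: "('a, 'b) pre_digraph \<Rightarrow> ('b \<Rightarrow> 'c::ab_group_add) \<Rightarrow> 'a \<Rightarrow> 'c" where
  "boundary G \<phi> v = (\<Sum>e\<in>out_arcs G v. \<phi> e) - (\<Sum>e\<in>in_arcs G v. \<phi> e)"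

definition vsupp :: "('a, 'b) pre_digraph \<Rightarrow> ('a \<Rightarrow> 'c::zero) \<Rightarrow> 'a set" where
  "vsupp G f = {v \<in> verts G. f v \<noteq> 0}"

definition cut_size :: "('a, 'b) pre_digraph \<Rightarrow> 'a set \<Rightarrow> nat" where
  "cut_size G X = card {e \<in> arcs G. (tail G e \<in> X) \<noteq> (head G e \<in> X)}"

end

theory Submission
  imports Defs
begin

text \<open>
  Induction on the number of vertices, in a form that does not assume connectedness. Suppose that
  \<open>j\<close> is a \<open>\<int>\<^sub>2\<close>-valued function with boundary support \<open>T\<close> and that \<open>X\<close> is a connected
  component of its support containing at least two vertices of \<open>U\<close> (or that \<open>U\<close> is empty and \<open>X\<close>
  is a single vertex). Delete \<open>X\<close>, add the neighbours of \<open>X\<close> to \<open>U\<close>, and solve the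
  rest. Every edge leaving \<open>X\<close> can then be given a nonzero \<open>\<int>\<^sub>3\<close>-value that corrects
  the boundary at its outer end. Every edge meeting \<open>X\<close> that is not in the support of \<open>j\<close> has a
  nonzero \<open>\<int>\<^sub>3\<close>-value, so \<open>j\<close> may serve as \<open>\<phi>\<^sub>2\<close> there, and the support of \<open>j\<close> is free to
  route arbitrary \<open>\<int>\<^sub>3\<close>-values inside \<open>X\<close>; the two vertices of \<open>U\<close> absorb the total.

  If \<open>T\<close> is nonempty, any such \<open>j\<close> works, because a component of its support that meets \<open>T\<close>
  does so at least twice. If \<open>T\<close> is empty, either an edge cut of size one splits the problem into
  two, matched by a change of sign, or two vertices of \<open>U\<close> are joined by an integral flow of value
  two with values in \<open>{-1, 0, 1}\<close>, whose reduction modulo 2 is the required \<open>j\<close>.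
\<close>

section \<open>Arithmetic in Z_2 and Z_3\<close>

lemma num2_cases: "(x::2) = 0 \<or> x = 1"
proof (induct x)
  case (of_int z)
  then have "z = 0 \<or> z = 1" by auto
  then show ?case by auto
qed

lemma num3_cases: "(x::3) = 0 \<or> x = 1 \<or> x = -1"
proof (induct x)
  case (of_int z)
  then have "z = 0 \<or> z = 1 \<or> z = 2" by auto
  moreover have "(2::3) = -1" by simp
  ultimately show ?case by auto
qed

lemma of_nat_2_eq_0_iff: "(of_nat n :: 2) = 0 \<longleftrightarrow> even n"
proof (cases "even n")
  case True
  then obtain k where "n = 2 * k" by auto
  moreover have "(2::2) = 0" by simp
  ultimately show ?thesis
    using True by (simp only: of_nat_mult of_nat_numeral mult_zero_left) simp
next
  case False
  then obtain k where "n = Suc (2 * k)" by (auto elim: oddE)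
  moreover have "(2::2) = 0" by simp
  ultimately show ?thesis
    using False by (simp only: of_nat_Suc of_nat_mult of_nat_numeral mult_zero_left) simp
qed

text \<open>When an element is split off, one of the values 1 and -1 differs from \<open>c\<close>;
  giving it that value leaves a nonzero total for the others, which even a single remaining element
  can attain.\<close>

lemma sum_nonzero3:
  fixes c :: 3
  assumes "finite D" "D \<noteq> {}" "c \<noteq> 0 \<or> card D \<ge> 2"
  shows "\<exists>\<chi>. (\<forall>x\<in>D. \<chi> x \<noteq> 0) \<and> sum \<chi> D = c"
  using assms
proof (induction D arbitrary: c rule: finite_ne_induct)
  case (singleton x)
  then show ?case by (intro exI[of _ "\<lambda>_. c"]) auto
next
  case (insert x F)
  obtain s :: 3 where s: "s \<noteq> 0" "c - s \<noteq> 0"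
  proof (cases "c = 1")
    case True
    then show ?thesis by (intro that[of "-1"]) auto
  next
    case False
    then show ?thesis by (intro that[of 1]) auto
  qed
  obtain \<chi> where \<chi>: "\<forall>y\<in>F. \<chi> y \<noteq> 0" "sum \<chi> F = c - s"
    using insert.IH[of "c - s"] s by auto
  have "sum (\<chi>(x := s)) F = sum \<chi> F"
    using insert.hyps by (intro sum.cong) auto
  then show ?case
    using \<chi> s insert.hyps by (intro exI[of _ "\<chi>(x := s)"]) auto
qed

section \<open>Boundaries, cuts and connectedness\<close>

locale endpoints =
  fixes t h :: "'b \<Rightarrow> 'a"
begin

text \<open>The edge set is an argument while the endpoint maps are fixed, so passing to a smaller
  instance only shrinks sets. With one summand per edge a loop cancels at once, and identities can
  be checked edge by edge.\<close>

definition bd :: "'b set \<Rightarrow> ('b \<Rightarrow> 'c::ab_group_add) \<Rightarrow> 'a \<Rightarrow> 'c" where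
  "bd E \<phi> v = (\<Sum>e\<in>E. (if t e = v then \<phi> e else 0) - (if h e = v then \<phi> e else 0))"

definition cut :: "'b set \<Rightarrow> 'a set \<Rightarrow> 'b set" where
  "cut E X = {e \<in> E. (t e \<in> X) \<noteq> (h e \<in> X)}"

definition inner :: "'b set \<Rightarrow> 'a set \<Rightarrow> 'b set" where
  "inner E X = {e \<in> E. t e \<in> X \<and> h e \<in> X}"

text \<open>Cuts replace walks here: connectedness serves to show that a set with no leaving edge is
  everything, and its negation supplies a set at which to split the instance.\<close>

definition connected_by :: "'b set \<Rightarrow> 'a set \<Rightarrow> bool" where
  "connected_by E X \<longleftrightarrow> (\<forall>Y \<subseteq> X. Y \<noteq> {} \<longrightarrow> Y \<noteq> X \<longrightarrow> cut (inner E X) Y \<noteq> {})"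

lemma bd_add: "bd E (\<lambda>e. \<phi> e + \<psi> e) v = bd E \<phi> v + bd E \<psi> v"
  unfolding bd_def sum.distrib[symmetric] by (intro sum.cong) auto

lemma bd_uminus: "bd E (\<lambda>e. - \<phi> e) v = - bd E \<phi> v"
  unfolding bd_def sum_negf[symmetric] by (intro sum.cong) auto

lemma bd_zero [simp]: "bd E (\<lambda>e. 0) v = 0"
  unfolding bd_def by simp

lemma bd_sum: "bd E (\<lambda>e. \<Sum>i\<in>I. \<phi> i e) v = (\<Sum>i\<in>I. bd E (\<phi> i) v)"
  by (induction I rule: infinite_finite_induct) (simp_all add: bd_add)

lemma bd_cong:
  assumes "\<And>e. e \<in> E \<Longrightarrow> t e = v \<or> h e = v \<Longrightarrow> \<phi> e = \<psi> e"
  shows "bd E \<phi> v = bd E \<psi> v"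
  unfolding bd_def using assms by (intro sum.cong) auto

lemma bd_mono_neutral:
  assumes "finite E" "F \<subseteq> E" "\<And>e. e \<in> E - F \<Longrightarrow> t e = v \<or> h e = v \<Longrightarrow> \<phi> e = 0"
  shows "bd F \<phi> v = bd E \<phi> v"
  unfolding bd_def using assms by (intro sum.mono_neutral_left) auto

lemma bd_Un_disjoint:
  assumes "finite E" "finite F" "E \<inter> F = {}"
  shows "bd (E \<union> F) \<phi> v = bd E \<phi> v + bd F \<phi> v"
  unfolding bd_def using assms by (intro sum.union_disjoint) auto

lemma bd_of_int: "bd E (\<lambda>e. of_int (f e)) v = (of_int (bd E f v) :: 'c::ring_1)"
  unfolding bd_def of_int_sum by (intro sum.cong) auto

lemma bd_single:
  assumes "finite E" "e \<in> E"
  shows "bd E (\<lambda>x. if x = e then c else 0) v = (if t e = v then c else 0) - (if h e = v then c else 0)"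
proof -
  have "bd E (\<lambda>x. if x = e then c else 0) v =
    (\<Sum>x\<in>E. if x = e then (if t e = v then c else 0) - (if h e = v then c else 0) else 0)"
    unfolding bd_def by (intro sum.cong) auto
  then show ?thesis using assms by simp
qed

lemma sum_bd:
  assumes "finite X"
  shows "(\<Sum>v\<in>X. bd E \<phi> v) = (\<Sum>e\<in>E. (if t e \<in> X then \<phi> e else 0) - (if h e \<in> X then \<phi> e else 0))"
proof -
  have "(\<Sum>v\<in>X. bd E \<phi> v) = (\<Sum>e\<in>E. \<Sum>v\<in>X. (if t e = v then \<phi> e else 0) - (if h e = v then \<phi> e else 0))"
    unfolding bd_def by (rule sum.swap)
  also have "\<dots> = (\<Sum>e\<in>E. (if t e \<in> X then \<phi> e else 0) - (if h e \<in> X then \<phi> e else 0))"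
    using assms by (intro sum.cong) (simp_all add: sum_subtractf)
  finally show ?thesis .
qed

lemma sum_bd_eq_0:
  assumes "finite X" "\<And>e. e \<in> cut E X \<Longrightarrow> \<phi> e = 0"
  shows "(\<Sum>v\<in>X. bd E \<phi> v) = 0"
  unfolding sum_bd[OF assms(1)] using assms(2) by (intro sum.neutral) (auto simp: cut_def)

text \<open>Handshake argument: modulo 2 every nonzero boundary is 1, so the boundary sum over
  \<open>X\<close> counts \<open>T \<inter> X\<close>; it is 0 because \<open>j\<close> vanishes on
  the cut.\<close>

lemma even_card_supp_bd:
  fixes j :: "'b \<Rightarrow> 2"
  assumes "finite X" "\<And>e. e \<in> cut E X \<Longrightarrow> j e = 0" "\<And>v. v \<in> X \<Longrightarrow> bd E j v \<noteq> 0 \<longleftrightarrow> v \<in> T"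
  shows "even (card (T \<inter> X))"
proof -
  have "0 = (\<Sum>v\<in>X. bd E j v)"
    using sum_bd_eq_0[of X E j] assms by simp
  also have "\<dots> = (\<Sum>v\<in>X. if v \<in> T then 1 else 0)"
    using assms(3) num2_cases by (intro sum.cong refl) metis
  also have "\<dots> = of_nat (card (T \<inter> X))"
    using assms(1) by (simp add: sum.If_cases Int_commute)
  finally show ?thesis using of_nat_2_eq_0_iff by metis
qed

text \<open>It suffices to send an arbitrary amount from each \<open>x \<in> X\<close> to a fixed \<open>r \<in> X\<close>; the set of
  those \<open>x\<close> for which this is possible is not left by any edge of \<open>F\<close>.\<close>

lemma connected_by_route:
  fixes g :: "'a \<Rightarrow> 'c::ab_group_add"
  assumes "finite X" "finite E" "F \<subseteq> E" "connected_by F X" "sum g X = 0"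
  obtains \<psi> where "\<And>e. e \<notin> inner F X \<Longrightarrow> \<psi> e = 0" "\<And>v. v \<in> X \<Longrightarrow> bd E \<psi> v = g v"
proof (cases "X = {}")
  case True
  then show ?thesis using that[of "\<lambda>_. 0"] by simp
next
  case False
  then obtain r where r: "r \<in> X" by auto
  define unit where "unit x c v = (if v = x then c else 0)" for x v :: 'a and c :: 'c
  define good where "good x \<longleftrightarrow> (\<forall>c. \<exists>\<psi>. (\<forall>e. e \<notin> inner F X \<longrightarrow> \<psi> e = 0) \<and>
    (\<forall>v. bd E \<psi> v = unit x c v - unit r c v))" for x
  have step: "good y" if x: "good x" and e: "e \<in> inner F X" "{t e, h e} = {x, y}" for x y e
    unfolding good_def
  proof
    fix c
    obtain \<psi> where \<psi>: "\<And>e. e \<notin> inner F X \<Longrightarrow> \<psi> e = 0" "\<And>v. bd E \<psi> v = unit x c v - unit r c v"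
      using x unfolding good_def by metis
    \<comment> \<open>The sign of \<open>s\<close> accounts for the orientation of \<open>e\<close>:
      the source of the amount \<open>c\<close> moves from \<open>x\<close> to \<open>y\<close>
      whichever end of \<open>e\<close> is \<open>y\<close>.\<close>
    define s where "s = (if t e = y then c else - c)"
    have "e \<in> E" using e assms(3) by (auto simp: inner_def)
    then have "bd E (\<lambda>a. \<psi> a + (if a = e then s else 0)) v = unit y c v - unit r c v" for v
      using e(2) assms(2) unfolding bd_add \<psi>(2) s_def
      by (auto simp: bd_single unit_def doubleton_eq_iff)
    then show "\<exists>\<psi>. (\<forall>e. e \<notin> inner F X \<longrightarrow> \<psi> e = 0) \<and> (\<forall>v. bd E \<psi> v = unit y c v - unit r c v)"
      using \<psi>(1) e(1) by (intro exI[of _ "\<lambda>a. \<psi> a + (if a = e then s else 0)"]) auto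
  qed
  define S where "S = {x \<in> X. good x}"
  have "good r" unfolding good_def by (intro allI exI[of _ "\<lambda>_. 0"]) (simp add: unit_def)
  then have "r \<in> S" using r S_def by simp
  moreover have "cut (inner F X) S = {}"
    using step unfolding S_def cut_def inner_def
    by (smt (verit) Collect_empty_eq insert_commute mem_Collect_eq)
  moreover have "S \<subseteq> X" unfolding S_def by auto
  ultimately have "S = X"
    using assms(4) unfolding connected_by_def by (metis empty_iff)
  then have "\<forall>x\<in>X. good x" unfolding S_def by auto
  then have "\<forall>x\<in>X. \<exists>\<psi>. (\<forall>e. e \<notin> inner F X \<longrightarrow> \<psi> e = 0) \<and>
      (\<forall>v. bd E \<psi> v = unit x (g x) v - unit r (g x) v)"
    unfolding good_def by simp
  from bchoice[OF this]
  obtain \<psi> where \<psi>: "\<And>x e. x \<in> X \<Longrightarrow> e \<notin> inner F X \<Longrightarrow> \<psi> x e = 0"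
    "\<And>x v. x \<in> X \<Longrightarrow> bd E (\<psi> x) v = unit x (g x) v - unit r (g x) v"
    by auto
  show ?thesis
  proof (rule that[of "\<lambda>e. \<Sum>x\<in>X. \<psi> x e"])
    fix v assume v: "v \<in> X"
    have "bd E (\<lambda>e. \<Sum>x\<in>X. \<psi> x e) v = (\<Sum>x\<in>X. unit x (g x) v) - (\<Sum>x\<in>X. unit r (g x) v)"
      by (simp add: bd_sum \<psi>(2) sum_subtractf)
    also have "(\<Sum>x\<in>X. unit x (g x) v) = g v"
      using v assms(1) unfolding unit_def by simp
    \<comment> \<open>The amounts charged to the root \<open>r\<close> add up to the total of
      \<open>g\<close>, which is 0.\<close>
    also have "(\<Sum>x\<in>X. unit r (g x) v) = 0"
      using assms(5) unfolding unit_def by (cases "v = r") auto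
    finally show "bd E (\<lambda>e. \<Sum>x\<in>X. \<psi> x e) v = g v" by simp
  qed (simp add: \<psi>(1))
qed

section \<open>Integral flows of value two\<close>

text \<open>The integral analogue of Menger's theorem for two edge-disjoint paths. A unit flow from
  \<open>u\<close> to \<open>v\<close> is augmented once in its residual graph; if that is impossible, the residually
  reachable vertices form a set whose cut consists of a single edge.\<close>

lemma residual_reach:
  fixes Al :: "'b \<Rightarrow> int set"
  assumes "finite V" "finite E" "u \<in> V" "\<And>e. 0 \<in> Al e"
  obtains S where "S \<subseteq> V" "u \<in> S"
    "\<And>x. x \<in> S \<Longrightarrow> \<exists>f. (\<forall>e. f e \<in> Al e) \<and>
      (\<forall>v. bd E f v = (if v = u then 1 else 0) - (if v = x then 1 else 0))"
    "\<And>e. e \<in> E \<Longrightarrow> t e \<in> S \<Longrightarrow> h e \<in> V - S \<Longrightarrow> 1 \<notin> Al e"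
    "\<And>e. e \<in> E \<Longrightarrow> h e \<in> S \<Longrightarrow> t e \<in> V - S \<Longrightarrow> -1 \<notin> Al e"
proof -
  define flow where "flow f x \<longleftrightarrow> (\<forall>e. f e \<in> Al e) \<and>
      (\<forall>v. bd E f v = (if v = u then 1 else 0) - (if v = x then 1 else 0))" for f x
  \<comment> \<open>Flows to vertices of \<open>S\<close> are kept inside \<open>S\<close>. An edge
    leaving \<open>S\<close> then still carries 0, so any value in \<open>Al e\<close> may be added
    to it when \<open>S\<close> grows.\<close>
  define P where "P S \<longleftrightarrow> S \<subseteq> V \<and> u \<in> S \<and> 
    (\<forall>x\<in>S. \<exists>f. flow f x \<and> (\<forall>e. e \<notin> inner E S \<longrightarrow> f e = 0))" for S
  have "P {u}" using assms unfolding P_def flow_def by (auto intro!: exI[of _ "\<lambda>_. 0"])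
  moreover have "finite (Collect P)"
    by (rule finite_subset[of _ "Pow V"]) (use assms(1) in \<open>auto simp: P_def\<close>)
  ultimately obtain S where S: "P S" and max: "\<And>S'. P S' \<Longrightarrow> S \<subseteq> S' \<Longrightarrow> S' = S"
    using finite_has_maximal2[of "Collect P" "{u}"] by auto
  have no: False if e: "e \<in> E" "x \<in> S" "y \<in> V - S" "s \<in> Al e"
    "(t e = x \<and> h e = y \<and> s = 1) \<or> (h e = x \<and> t e = y \<and> s = -1)" for e x y s
  proof -
    have "P (insert y S)"
      unfolding P_def
    proof (intro conjI ballI)
      fix z assume z: "z \<in> insert y S"
      obtain f where f: "flow f (if z = y then x else z)" "\<And>a. a \<notin> inner E S \<Longrightarrow> f a = 0"
        using S z e(2) unfolding P_def by (metis insertE)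
      show "\<exists>f. flow f z \<and> (\<forall>e. e \<notin> inner E (insert y S) \<longrightarrow> f e = 0)"
      proof (cases "z = y")
        case False
        then show ?thesis using f by (intro exI[of _ f]) (auto simp: inner_def)
      next
        case True
        define g where "g a = f a + (if a = e then s else 0)" for a
        have "f e = 0" using f(2) e by (auto simp: inner_def)
        then have "g a \<in> Al a" for a
          using f(1) e(4) unfolding flow_def g_def by auto
        moreover have "bd E g v = (if v = u then 1 else 0) - (if v = y then 1 else 0)" for v
          using f(1) e(5) True unfolding flow_def g_def bd_add bd_single[OF assms(2) e(1)] by auto
        ultimately have "flow g z" using True unfolding flow_def by auto
        moreover have "\<forall>a. a \<notin> inner E (insert y S) \<longrightarrow> g a = 0"
          using f(2) e unfolding g_def inner_def by auto
        ultimately show ?thesis by blast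
      qed
    qed (use S e in \<open>auto simp: P_def\<close>)
    then show False using max[of "insert y S"] e(3) by auto
  qed
  show ?thesis
  proof (rule that[of S])
    show "\<exists>f. (\<forall>e. f e \<in> Al e) \<and>
      (\<forall>v. bd E f v = (if v = u then 1 else 0) - (if v = x then 1 else 0))" if "x \<in> S" for x
      using S that unfolding P_def flow_def by metis
  qed (use S no in \<open>auto simp: P_def\<close>)
qed

lemma two_unit_flow:
  assumes "finite V" "finite E" "connected_by E V" "\<And>e. e \<in> E \<Longrightarrow> t e \<in> V \<and> h e \<in> V"
    and "u \<in> V" "v \<in> V" "\<And>S. S \<subseteq> V \<Longrightarrow> card (cut E S) \<noteq> 1"
  obtains f :: "'b \<Rightarrow> int" where "\<And>e. f e \<in> {-1, 0, 1}"
    "\<And>x. bd E f x = (if x = u then 2 else 0) - (if x = v then 2 else 0)"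
proof -
  define B :: "int set" where "B = {-1, 0, 1}"
  have inn: "inner E V = E" using assms(4) by (auto simp: inner_def)
  obtain S where S: "S \<subseteq> V" "u \<in> S"
    "\<And>x. x \<in> S \<Longrightarrow> \<exists>f. (\<forall>e. f e \<in> B) \<and>
      (\<forall>v. bd E f v = (if v = u then 1 else 0) - (if v = x then 1 else 0))"
    "\<And>e. e \<in> E \<Longrightarrow> t e \<in> S \<Longrightarrow> h e \<in> V - S \<Longrightarrow> 1 \<notin> B"
    "\<And>e. e \<in> E \<Longrightarrow> h e \<in> S \<Longrightarrow> t e \<in> V - S \<Longrightarrow> -1 \<notin> B"
    using residual_reach[OF assms(1,2,5), of "\<lambda>_. B"] unfolding B_def by auto
  have "cut E S = {}" using S(4,5) assms(4) unfolding cut_def B_def by blast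
  then have "v \<in> S" using assms(3,6) S(1,2) unfolding connected_by_def inn by blast
  then obtain f where f: "\<And>e. f e \<in> B"
    "\<And>x. bd E f x = (if x = u then 1 else 0) - (if x = v then 1 else 0)"
    using S(3) by metis
  \<comment> \<open>The allowed increments now describe the residual graph of
    \<open>f\<close>.\<close>
  obtain S where S: "S \<subseteq> V" "u \<in> S"
    "\<And>x. x \<in> S \<Longrightarrow> \<exists>g. (\<forall>e. g e \<in> {z \<in> B. f e + z \<in> B}) \<and>
      (\<forall>v. bd E g v = (if v = u then 1 else 0) - (if v = x then 1 else 0))"
    "\<And>e. e \<in> E \<Longrightarrow> t e \<in> S \<Longrightarrow> h e \<in> V - S \<Longrightarrow> 1 \<notin> {z \<in> B. f e + z \<in> B}"
    "\<And>e. e \<in> E \<Longrightarrow> h e \<in> S \<Longrightarrow> t e \<in> V - S \<Longrightarrow> -1 \<notin> {z \<in> B. f e + z \<in> B}"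
    using residual_reach[OF assms(1,2,5), of "\<lambda>e. {z \<in> B. f e + z \<in> B}"] f(1) unfolding B_def by auto
  have "v \<in> S"
  proof (rule ccontr)
    assume v: "v \<notin> S"
    have fS: "finite S" using S(1) assms(1) finite_subset by blast
    have "(\<Sum>x\<in>S. bd E f x) = 1"
      using S(2) v fS unfolding f(2) sum_subtractf by simp
    \<comment> \<open>If \<open>v\<close> is not reached, every cut edge is saturated:
      \<open>f\<close> is 1 on edges leaving \<open>S\<close> and -1 on edges entering it. Each
      contributes 1 to the net outflow, which is 1, so the cut is a single edge.\<close>
    moreover have "(\<Sum>x\<in>S. bd E f x) = (\<Sum>e\<in>E. if e \<in> cut E S then 1 else 0)"
      unfolding sum_bd[OF fS]
    proof (intro sum.cong refl)
      fix e assume e: "e \<in> E"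
      then show "(if t e \<in> S then f e else 0) - (if h e \<in> S then f e else 0) = (if e \<in> cut E S then 1 else 0)"
        using S(4,5)[OF e] assms(4)[OF e] f(1)[of e] unfolding B_def cut_def by auto
    qed
    moreover have "\<dots> = int (card (cut E S))"
    proof -
      have "{e \<in> E. e \<in> cut E S} = cut E S" by (auto simp: cut_def)
      then show ?thesis using assms(2) by (simp add: sum.If_cases Int_def)
    qed
    ultimately show False using assms(7)[OF S(1)] by simp
  qed
  then obtain g where g: "\<And>e. g e \<in> {z \<in> B. f e + z \<in> B}"
    "\<And>x. bd E g x = (if x = u then 1 else 0) - (if x = v then 1 else 0)"
    using S(3) by metis
  show ?thesis
    by (rule that[of "\<lambda>e. f e + g e"]) (use g(1) in \<open>auto simp: bd_add f(2) g(2) B_def\<close>)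
qed

section \<open>Admissible instances and the core\<close>

text \<open>The hypotheses of the theorem in a form fit for disconnected instances: the conditions
  on \<open>T\<close> and \<open>U\<close> are imposed on every union of components, and a cut of
  size 0 is permitted.\<close>

definition admissible :: "'a set \<Rightarrow> 'b set \<Rightarrow> 'a set \<Rightarrow> 'a set \<Rightarrow> bool" where
  "admissible V E T U \<longleftrightarrow> finite V \<and> finite E \<and> (\<forall>e\<in>E. t e \<in> V \<and> h e \<in> V) \<and> T \<subseteq> U \<and> U \<subseteq> V \<and>
    (\<forall>Z\<subseteq>V. cut E Z = {} \<longrightarrow> even (card (T \<inter> Z)) \<and> card (U \<inter> Z) \<noteq> 1) \<and>
    (\<forall>Z\<subseteq>V. Z \<inter> U = {} \<longrightarrow> card (cut E Z) \<noteq> 1)"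

definition solves :: "'a set \<Rightarrow> 'b set \<Rightarrow> 'a set \<Rightarrow> 'a set \<Rightarrow> ('b \<Rightarrow> 2) \<Rightarrow> ('b \<Rightarrow> 3) \<Rightarrow> bool" where
  "solves V E T U \<phi>2 \<phi>3 \<longleftrightarrow> (\<forall>e\<in>E. \<phi>2 e \<noteq> 0 \<or> \<phi>3 e \<noteq> 0) \<and>
    (\<forall>v\<in>V. bd E \<phi>2 v \<noteq> 0 \<longleftrightarrow> v \<in> T) \<and> (\<forall>v\<in>V. bd E \<phi>3 v \<noteq> 0 \<longleftrightarrow> v \<in> U)"

text \<open>Boundaries sum to zero over a set without leaving edges, so a vertex that is the only element
  of \<open>U\<close> in such a set cannot have a nonzero boundary.\<close>

definition core :: "'a set \<Rightarrow> 'b set \<Rightarrow> 'a set \<Rightarrow> 'a set" where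
  "core V E U = U - {w. \<exists>Z\<subseteq>V. cut E Z = {} \<and> U \<inter> Z = {w}}"

lemma admissibleD:
  assumes "admissible V E T U"
  shows "finite V" "finite E" "\<And>e. e \<in> E \<Longrightarrow> t e \<in> V \<and> h e \<in> V" "T \<subseteq> U" "U \<subseteq> V"
    "\<And>Z. Z \<subseteq> V \<Longrightarrow> cut E Z = {} \<Longrightarrow> even (card (T \<inter> Z))"
    "\<And>Z. Z \<subseteq> V \<Longrightarrow> cut E Z = {} \<Longrightarrow> card (U \<inter> Z) \<noteq> 1"
    "\<And>Z. Z \<subseteq> V \<Longrightarrow> Z \<inter> U = {} \<Longrightarrow> card (cut E Z) \<noteq> 1"
  using assms unfolding admissible_def by blast+

lemma cut_Diff_closed:
  assumes "cut E M = {}"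
  shows "cut E (Z - M) = {e \<in> cut E Z. t e \<notin> M}"
proof -
  have "t e \<in> M \<longleftrightarrow> h e \<in> M" if "e \<in> E" for e using assms that by (auto simp: cut_def)
  then show ?thesis by (auto simp: cut_def)
qed

lemma cut_UN_closed:
  assumes "\<And>i. i \<in> I \<Longrightarrow> cut E (M i) = {}"
  shows "cut E (\<Union>i\<in>I. M i) = {}"
proof -
  have "t e \<in> M i \<longleftrightarrow> h e \<in> M i" if "e \<in> E" "i \<in> I" for e i
    using assms that by (auto simp: cut_def)
  then show ?thesis by (auto simp: cut_def)
qed

text \<open>A vertex \<open>w\<close> is dropped because of a set \<open>K w\<close> that no edge
  leaves and that meets \<open>U\<close> only in \<open>w\<close>; parity keeps such
  \<open>w\<close> out of \<open>T\<close>. A set violating another condition for the core is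
  stripped of \<open>K x\<close> for each dropped \<open>x\<close> in it: either its last vertex of
  \<open>U\<close> turns out to be dropped as well, or a forbidden bridge for \<open>U\<close>
  appears.\<close>

lemma admissible_core:
  assumes "finite V" "finite E" "\<And>e. e \<in> E \<Longrightarrow> t e \<in> V \<and> h e \<in> V" "T \<subseteq> U" "U \<subseteq> V"
    and ev: "\<And>Z. Z \<subseteq> V \<Longrightarrow> cut E Z = {} \<Longrightarrow> even (card (T \<inter> Z))"
    and br: "\<And>Z. Z \<subseteq> V \<Longrightarrow> Z \<inter> U = {} \<Longrightarrow> card (cut E Z) \<noteq> 1"
  shows "admissible V E T (core V E U)"
proof -
  define R where "R = {w. \<exists>Z\<subseteq>V. cut E Z = {} \<and> U \<inter> Z = {w}}"
  have core: "core V E U = U - R" unfolding core_def R_def ..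
  have "\<forall>w\<in>R. \<exists>Z\<subseteq>V. cut E Z = {} \<and> U \<inter> Z = {w}" unfolding R_def by auto
  then obtain K where K: "\<And>w. w \<in> R \<Longrightarrow> K w \<subseteq> V" "\<And>w. w \<in> R \<Longrightarrow> cut E (K w) = {}"
    "\<And>w. w \<in> R \<Longrightarrow> U \<inter> K w = {w}"
    by metis
  have KE: "t e \<in> K w \<longleftrightarrow> h e \<in> K w" if "w \<in> R" "e \<in> E" for w e
    using K(2) that unfolding cut_def by blast
  have TU: "T \<subseteq> U - R"
  proof
    fix w assume w: "w \<in> T"
    have "w \<notin> R"
    proof
      assume r: "w \<in> R"
      then have "T \<inter> K w = {w}" using w assms(4) K(3)[OF r] by auto
      then show False using ev[OF K(1)[OF r] K(2)[OF r]] by simp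
    qed
    then show "w \<in> U - R" using w assms(4) by auto
  qed
  have closed: "card ((U - R) \<inter> Z) \<noteq> 1" if Z: "Z \<subseteq> V" "cut E Z = {}" for Z
  proof
    assume "card ((U - R) \<inter> Z) = 1"
    then obtain w where w: "(U - R) \<inter> Z = {w}" by (auto simp: card_Suc_eq One_nat_def)
    define Z' where "Z' = Z - (\<Union>x\<in>R \<inter> Z. K x)"
    have "cut E Z' = {}"
      unfolding Z'_def by (subst cut_Diff_closed[OF cut_UN_closed]) (use Z(2) K(2) in auto)
    moreover have "U \<inter> Z' = {w}"
    proof -
      have wU: "w \<in> U" "w \<notin> R" "w \<in> Z" using w by auto
      have "w \<notin> K x" if "x \<in> R" for x using K(3)[OF that] wU(1,2) that by (metis IntI singletonD)
      moreover have "x \<in> K x" if "x \<in> R" for x using K(3)[OF that] by auto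
      ultimately show ?thesis using w wU unfolding Z'_def by auto
    qed
    moreover have "Z' \<subseteq> V" using Z(1) unfolding Z'_def by auto
    ultimately have "w \<in> R" unfolding R_def by blast
    then show False using w by auto
  qed
  have bridge: "card (cut E Z) \<noteq> 1" if Z: "Z \<subseteq> V" "Z \<inter> (U - R) = {}" for Z
  proof
    assume "card (cut E Z) = 1"
    then obtain e where e: "cut E Z = {e}" by (auto simp: card_Suc_eq One_nat_def)
    show False
    proof (cases "\<exists>w\<in>R \<inter> Z. t e \<in> K w")
      case True
      then obtain w where w: "w \<in> R" "w \<in> Z" "t e \<in> K w" by auto
      \<comment> \<open>The bridge \<open>e\<close> lies inside \<open>K w\<close> and would be lost
        with it. The part of \<open>K w\<close> beyond \<open>Z\<close> still has cut
        \<open>{e}\<close> and misses \<open>w\<close>.\<close>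
      have "cut E (K w - Z) = {e}"
      proof -
        have "a \<in> cut E (K w - Z) \<longleftrightarrow> a \<in> cut E Z \<and> t a \<in> K w" for a
          using KE[OF w(1), of a] by (auto simp: cut_def)
        then show ?thesis using e w(3) by auto
      qed
      moreover have "(K w - Z) \<inter> U = {}" using K(3)[OF w(1)] w(2) by auto
      moreover have "K w - Z \<subseteq> V" using K(1)[OF w(1)] by auto
      ultimately show False using br[of "K w - Z"] by simp
    next
      case False
      define Z' where "Z' = Z - (\<Union>x\<in>R \<inter> Z. K x)"
      have "cut E Z' = {e}"
        unfolding Z'_def by (subst cut_Diff_closed[OF cut_UN_closed]) (use e False K(2) in auto)
      moreover have "Z' \<inter> U = {}"
      proof -
        have "x \<in> K x" if "x \<in> R" for x using K(3)[OF that] by auto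
        then show ?thesis using Z(2) unfolding Z'_def by auto
      qed
      moreover have "Z' \<subseteq> V" using Z(1) unfolding Z'_def by auto
      ultimately show False using br[of Z'] by simp
    qed
  qed
  show ?thesis
    unfolding admissible_def core
    by (intro conjI allI ballI impI) (use assms(1-3,5) TU ev closed bridge in \<open>simp_all add: Diff_subset subset_trans[of "U - R" U V]\<close>)
qed

section \<open>Extension across a cut, and gluing\<close>

text \<open>The edges leaving \<open>C\<close> cost nothing for \<open>\<phi>2\<close> and are all nonzero for \<open>\<phi>3\<close>. A vertex outside
  \<open>U\<close> dropped by \<^const>\<open>core\<close> is incident to at least two of them, so that nonzero values can cancel.\<close>

lemma extend_to_cut:
  assumes adm: "admissible V E T U" and C: "C \<subseteq> V"
    and ev: "\<And>Z. Z \<subseteq> C \<Longrightarrow> cut (inner E C) Z = {} \<Longrightarrow> even (card (T \<inter> Z))"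
    and IH: "\<And>E' T' U'. admissible C E' T' U' \<Longrightarrow> \<exists>\<phi>2 \<phi>3. solves C E' T' U' \<phi>2 \<phi>3"
  obtains \<phi>2 :: "'b \<Rightarrow> 2" and \<phi>3 :: "'b \<Rightarrow> 3"
  where "\<And>e. e \<in> inner E C \<Longrightarrow> \<phi>2 e \<noteq> 0 \<or> \<phi>3 e \<noteq> 0"
    "\<And>e. e \<in> cut E C \<Longrightarrow> \<phi>2 e = 0" "\<And>e. e \<in> cut E C \<Longrightarrow> \<phi>3 e \<noteq> 0"
    "\<And>v. v \<in> C \<Longrightarrow> bd E \<phi>2 v \<noteq> 0 \<longleftrightarrow> v \<in> T"
    "\<And>v. v \<in> C \<Longrightarrow> bd E \<phi>3 v \<noteq> 0 \<longleftrightarrow> v \<in> U"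
proof -
  note A = admissibleD[OF adm]
  define E' where "E' = inner E C"
  define D where "D w = {e \<in> cut E C. t e = w \<or> h e = w}" for w
  define W where "W = {w \<in> C. D w \<noteq> {}}"
  \<comment> \<open>Attachment vertices are added to \<open>U\<close> for the inner instance, since
    the edges in \<open>D w\<close> can restore the boundary wanted at \<open>w\<close>;
    \<open>core\<close> then discards vertices whose boundary is forced to be 0.\<close>
  define U1 where "U1 = (U \<inter> C) \<union> W"
  define U' where "U' = core C E' U1"
  have fin: "finite C" "finite E'" "finite (cut E C)" "\<And>w. finite (D w)"
    using A(1,2) C finite_subset unfolding E'_def inner_def cut_def D_def by auto
  have cutZ: "cut E Z = cut E' Z \<union> (\<Union>w\<in>W \<inter> Z. D w)" if "Z \<subseteq> C" for Z
  proof (intro set_eqI iffI)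
    fix e assume e: "e \<in> cut E Z"
    show "e \<in> cut E' Z \<union> (\<Union>w\<in>W \<inter> Z. D w)"
    proof (cases "e \<in> E'")
      case True
      then show ?thesis using e by (auto simp: cut_def)
    next
      case False
      then have "e \<in> cut E C" using e that by (auto simp: cut_def E'_def inner_def)
      then have "e \<in> D (if t e \<in> Z then t e else h e)" unfolding D_def by auto
      moreover have "(if t e \<in> Z then t e else h e) \<in> Z" using e by (auto simp: cut_def)
      ultimately show ?thesis using that unfolding W_def by blast
    qed
  next
    fix e assume "e \<in> cut E' Z \<union> (\<Union>w\<in>W \<inter> Z. D w)"
    then show "e \<in> cut E Z"
      using that by (auto simp: E'_def inner_def cut_def D_def)
  qed
  have adm': "admissible C E' (T \<inter> C) U'"
    unfolding U'_def
  proof (rule admissible_core)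
    show "even (card (T \<inter> C \<inter> Z))" if "Z \<subseteq> C" "cut E' Z = {}" for Z
      using ev[of Z] that unfolding E'_def by (simp add: Int_assoc Int_absorb1)
    show "card (cut E' Z) \<noteq> 1" if Z: "Z \<subseteq> C" "Z \<inter> U1 = {}" for Z
    proof -
      have "W \<inter> Z = {}" "Z \<inter> U = {}" using Z unfolding U1_def by auto
      then show ?thesis using A(8)[of Z] cutZ[OF Z(1)] Z(1) C by simp
    qed
  qed (use fin A(4) in \<open>auto simp: E'_def inner_def U1_def W_def\<close>)
  obtain \<phi>2' :: "'b \<Rightarrow> 2" and \<phi>3' :: "'b \<Rightarrow> 3" where sol: "solves C E' (T \<inter> C) U' \<phi>2' \<phi>3'"
    using IH[OF adm'] by auto
  define d where "d = bd E' \<phi>3'"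
  have d: "d v \<noteq> 0 \<longleftrightarrow> v \<in> U'" if "v \<in> C" for v
    using sol that unfolding solves_def d_def by auto
  have d0: "\<exists>Z\<subseteq>C. cut E' Z = {} \<and> U1 \<inter> Z = {v}" if "v \<in> U1" "d v = 0" for v
    using d[of v] that unfolding U'_def core_def U1_def W_def by auto
  \<comment> \<open>Away from \<open>W\<close>, \<open>core\<close> discards no vertex of
    \<open>U\<close>: a witness \<open>Z\<close> would have no leaving edge in \<open>E\<close>
    either, and admissibility forbids it to meet \<open>U\<close> exactly once.\<close>
  have dU: "d v \<noteq> 0 \<longleftrightarrow> v \<in> U" if v: "v \<in> C" "v \<notin> W" for v
  proof
    assume "d v \<noteq> 0"
    then show "v \<in> U" using d[of v] v unfolding U'_def core_def U1_def by auto
  next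
    assume vU: "v \<in> U"
    show "d v \<noteq> 0"
    proof
      assume "d v = 0"
      then obtain Z where Z: "Z \<subseteq> C" "cut E' Z = {}" "U1 \<inter> Z = {v}"
        using d0[of v] vU v unfolding U1_def by blast
      then have "W \<inter> Z = {}" "U \<inter> Z = {v}" using v vU unfolding U1_def by auto
      then show False using A(7)[OF subset_trans[OF Z(1) C]] cutZ[OF Z(1)] Z(2) by simp
    qed
  qed
  \<comment> \<open>This is what \<open>D w\<close> must contribute at \<open>w\<close>:
    \<open>- d w\<close> cancels, while adding \<open>d w\<close> doubles it, which keeps it nonzero
    in Z_3. It vanishes only if \<open>d w = 0\<close> and \<open>w\<close> is outside
    \<open>U\<close>.\<close>
  define c where "c w = (if d w \<noteq> 0 then (if w \<in> U then d w else - d w) else if w \<in> U then 1 else 0)" for w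
  have c: "c w \<noteq> 0 \<or> card (D w) \<ge> 2" if w: "w \<in> W" for w
  proof (cases "d w = 0 \<and> w \<notin> U")
    case True
    \<comment> \<open>The witness of \<open>core\<close> avoids \<open>U\<close> and its cut in
      \<open>E\<close> is exactly \<open>D w\<close>, so admissibility rules out a single
      edge.\<close>
    then obtain Z where Z: "Z \<subseteq> C" "cut E' Z = {}" "U1 \<inter> Z = {w}"
      using d0[of w] w unfolding U1_def by blast
    then have "W \<inter> Z = {w}" "Z \<inter> U = {}" using w True unfolding U1_def by auto
    then have "card (D w) \<noteq> 1" using A(8)[OF subset_trans[OF Z(1) C]] cutZ[OF Z(1)] Z(2) by simp
    moreover have "card (D w) \<noteq> 0" using w fin(4) unfolding W_def by simp
    ultimately show ?thesis by linarith
  qed (auto simp: c_def)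
  have "\<forall>w\<in>W. \<exists>\<chi>. (\<forall>e\<in>D w. \<chi> e \<noteq> 0) \<and> sum \<chi> (D w) = c w"
  proof
    fix w assume w: "w \<in> W"
    have Dw: "D w \<noteq> {}" using w unfolding W_def by auto
    show "\<exists>\<chi>. (\<forall>e\<in>D w. \<chi> e \<noteq> 0) \<and> sum \<chi> (D w) = c w"
      by (rule sum_nonzero3[OF fin(4) Dw c[OF w]])
  qed
  from bchoice[OF this] obtain \<chi> where \<chi>': "\<forall>w\<in>W. (\<forall>e\<in>D w. \<chi> w e \<noteq> 0) \<and> sum (\<chi> w) (D w) = c w"
    by (rule exE)
  have \<chi>: "\<And>w e. w \<in> W \<Longrightarrow> e \<in> D w \<Longrightarrow> \<chi> w e \<noteq> 0"
    "\<And>w. w \<in> W \<Longrightarrow> sum (\<chi> w) (D w) = c w"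
    using \<chi>' by blast+
  define \<phi>2 where "\<phi>2 e = (if e \<in> E' then \<phi>2' e else 0)" for e
  \<comment> \<open>A cut edge has one end \<open>w\<close> in \<open>C\<close>; the sign makes its
    contribution to the boundary at \<open>w\<close> equal to \<open>\<chi> w e\<close> in both
    orientations.\<close>
  define \<phi>3 where "\<phi>3 e = (if e \<in> E' then \<phi>3' e else if t e \<in> C then \<chi> (t e) e else - \<chi> (h e) e)" for e
  have disj: "E' \<inter> cut E C = {}" unfolding E'_def inner_def cut_def by auto
  have split: "bd E \<phi> v = bd E' \<phi> v + bd (cut E C) \<phi> v" if "v \<in> C" for v and \<phi> :: "'b \<Rightarrow> 'd::ab_group_add"
    unfolding bd_Un_disjoint[OF fin(2,3) disj, symmetric]
    by (rule bd_mono_neutral[symmetric]) (use A(2) that in \<open>auto simp: E'_def inner_def cut_def\<close>)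
  have bd2: "bd E \<phi>2 v = bd E' \<phi>2' v" if "v \<in> C" for v
  proof -
    have "bd E' \<phi>2 v = bd E' \<phi>2' v" by (rule bd_cong) (simp add: \<phi>2_def)
    moreover have "bd (cut E C) \<phi>2 v = bd (cut E C) (\<lambda>_. 0) v"
      by (rule bd_cong) (use disj in \<open>auto simp: \<phi>2_def\<close>)
    ultimately show ?thesis using split[OF that, of \<phi>2] by simp
  qed
  have bdcut: "bd (cut E C) \<phi>3 v = (if v \<in> W then c v else 0)" if v: "v \<in> C" for v
  proof -
    have "bd (cut E C) \<phi>3 v = (\<Sum>e\<in>cut E C. if e \<in> D v then \<chi> v e else 0)"
      unfolding bd_def
      by (intro sum.cong) (use v disj in \<open>auto simp: \<phi>3_def D_def cut_def\<close>)
    also have "\<dots> = sum (\<chi> v) (D v)"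
      using fin(3) by (simp add: sum.If_cases Int_absorb1 D_def Int_def conj_commute)
    finally show ?thesis using \<chi>(2) v unfolding W_def by auto
  qed
  have bd3: "bd E \<phi>3 v = d v + (if v \<in> W then c v else 0)" if "v \<in> C" for v
  proof -
    have "bd E' \<phi>3 v = d v" unfolding d_def by (rule bd_cong) (simp add: \<phi>3_def)
    then show ?thesis using split[OF that, of \<phi>3] bdcut[OF that] by simp
  qed
  show ?thesis
  proof (rule that[of \<phi>2 \<phi>3])
    show "\<phi>2 e \<noteq> 0 \<or> \<phi>3 e \<noteq> 0" if "e \<in> inner E C" for e
      using that sol unfolding solves_def \<phi>2_def \<phi>3_def E'_def by auto
    show "\<phi>2 e = 0" if "e \<in> cut E C" for e
      using that disj unfolding \<phi>2_def by auto
    show "\<phi>3 e \<noteq> 0" if e: "e \<in> cut E C" for e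
    proof -
      have "t e \<in> C \<Longrightarrow> t e \<in> W \<and> e \<in> D (t e)" "t e \<notin> C \<Longrightarrow> h e \<in> W \<and> e \<in> D (h e)"
        using e unfolding W_def D_def cut_def by auto
      then show ?thesis using e disj \<chi>(1) unfolding \<phi>3_def by auto
    qed
    show "bd E \<phi>2 v \<noteq> 0 \<longleftrightarrow> v \<in> T" if "v \<in> C" for v
      using sol that bd2[OF that] unfolding solves_def by auto
    show "bd E \<phi>3 v \<noteq> 0 \<longleftrightarrow> v \<in> U" if v: "v \<in> C" for v
    proof (cases "v \<in> W")
      case True
      have "d v + d v \<noteq> 0" if "d v \<noteq> 0" using num3_cases[of "d v"] that by auto
      then show ?thesis using True unfolding bd3[OF v] c_def by auto
    qed (simp add: bd3[OF v] dU[OF v])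
  qed
qed

text \<open>The two sides are solved independently. Their Z_3-values can disagree only on a single
  cut edge; distinct nonzero elements of Z_3 are negatives of each other, so negating one side
  repairs this without changing where boundaries vanish. The bound also admits an empty cut, which
  handles disconnected instances.\<close>

lemma glue:
  assumes adm: "admissible V E T U" and C: "C \<subseteq> V"
    and evC: "\<And>Z. Z \<subseteq> C \<Longrightarrow> cut (inner E C) Z = {} \<Longrightarrow> even (card (T \<inter> Z))"
    and evD: "\<And>Z. Z \<subseteq> V - C \<Longrightarrow> cut (inner E (V - C)) Z = {} \<Longrightarrow> even (card (T \<inter> Z))"
    and IHC: "\<And>E' T' U'. admissible C E' T' U' \<Longrightarrow> \<exists>\<phi>2 \<phi>3. solves C E' T' U' \<phi>2 \<phi>3"
    and IHD: "\<And>E' T' U'. admissible (V - C) E' T' U' \<Longrightarrow> \<exists>\<phi>2 \<phi>3. solves (V - C) E' T' U' \<phi>2 \<phi>3"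
    and small: "card (cut E C) \<le> 1"
  shows "\<exists>\<phi>2 \<phi>3. solves V E T U \<phi>2 \<phi>3"
proof -
  note A = admissibleD[OF adm]
  have cutD: "cut E (V - C) = cut E C" using A(3) C unfolding cut_def by auto
  obtain \<phi>2 :: "'b \<Rightarrow> 2" and \<phi>3 :: "'b \<Rightarrow> 3" where \<phi>:
    "\<And>e. e \<in> inner E C \<Longrightarrow> \<phi>2 e \<noteq> 0 \<or> \<phi>3 e \<noteq> 0"
    "\<And>e. e \<in> cut E C \<Longrightarrow> \<phi>2 e = 0" "\<And>e. e \<in> cut E C \<Longrightarrow> \<phi>3 e \<noteq> 0"
    "\<And>v. v \<in> C \<Longrightarrow> bd E \<phi>2 v \<noteq> 0 \<longleftrightarrow> v \<in> T"
    "\<And>v. v \<in> C \<Longrightarrow> bd E \<phi>3 v \<noteq> 0 \<longleftrightarrow> v \<in> U"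
    using extend_to_cut[OF adm C evC IHC] by blast
  obtain \<psi>2 :: "'b \<Rightarrow> 2" and \<psi> :: "'b \<Rightarrow> 3" where \<psi>:
    "\<And>e. e \<in> inner E (V - C) \<Longrightarrow> \<psi>2 e \<noteq> 0 \<or> \<psi> e \<noteq> 0"
    "\<And>e. e \<in> cut E C \<Longrightarrow> \<psi>2 e = 0" "\<And>e. e \<in> cut E C \<Longrightarrow> \<psi> e \<noteq> 0"
    "\<And>v. v \<in> V - C \<Longrightarrow> bd E \<psi>2 v \<noteq> 0 \<longleftrightarrow> v \<in> T"
    "\<And>v. v \<in> V - C \<Longrightarrow> bd E \<psi> v \<noteq> 0 \<longleftrightarrow> v \<in> U"
    using extend_to_cut[OF adm Diff_subset evD IHD] unfolding cutD by blast
  have "\<exists>\<psi>3. (\<forall>e\<in>cut E C. \<psi>3 e = \<phi>3 e) \<and> (\<forall>e. \<psi>3 e = 0 \<longleftrightarrow> \<psi> e = 0) \<and>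
    (\<forall>v. bd E \<psi>3 v = 0 \<longleftrightarrow> bd E \<psi> v = 0)"
  proof (cases "\<forall>e\<in>cut E C. \<psi> e = \<phi>3 e")
    case False
    then obtain e where e: "e \<in> cut E C" "\<psi> e \<noteq> \<phi>3 e" by auto
    have "finite (cut E C)" using A(2) by (simp add: cut_def)
    then have "cut E C = {e}" using e(1) small by (metis card_le_Suc0_iff_eq One_nat_def is_singletonI' is_singleton_the_elem singletonD equals0D)
    moreover have "- \<psi> e = \<phi>3 e"
      using e \<phi>(3)[OF e(1)] \<psi>(3)[OF e(1)] num3_cases[of "\<psi> e"] num3_cases[of "\<phi>3 e"] by auto
    ultimately show ?thesis by (intro exI[of _ "\<lambda>e. - \<psi> e"]) (simp add: bd_uminus)
  qed auto
  then obtain \<psi>3 where \<psi>3: "\<And>e. e \<in> cut E C \<Longrightarrow> \<psi>3 e = \<phi>3 e" "\<And>e. \<psi>3 e = 0 \<longleftrightarrow> \<psi> e = 0"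
    "\<And>v. bd E \<psi>3 v = 0 \<longleftrightarrow> bd E \<psi> v = 0"
    by metis
  define f2 where "f2 e = (if e \<in> inner E C then \<phi>2 e else \<psi>2 e)" for e
  define f3 where "f3 e = (if e \<in> inner E C then \<phi>3 e else \<psi>3 e)" for e
  have "bd E f2 v = (if v \<in> C then bd E \<phi>2 v else bd E \<psi>2 v)"
    and "bd E f3 v = (if v \<in> C then bd E \<phi>3 v else bd E \<psi>3 v)" for v
    using \<phi>(2) \<psi>(2) \<psi>3(1) unfolding f2_def f3_def
    by (auto intro!: bd_cong simp: inner_def cut_def)
  moreover have "f2 e \<noteq> 0 \<or> f3 e \<noteq> 0" if "e \<in> E" for e
  proof -
    consider "e \<in> inner E C" | "e \<in> cut E C" "e \<notin> inner E C" | "e \<in> inner E (V - C)" "e \<notin> inner E C"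
      using \<open>e \<in> E\<close> A(3)[OF \<open>e \<in> E\<close>] unfolding inner_def cut_def by (cases "t e \<in> C"; cases "h e \<in> C") auto
    then show ?thesis
      by cases (use \<phi>(1,3) \<psi>(1) \<psi>3(1,2) in \<open>auto simp: f2_def f3_def\<close>)
  qed
  ultimately have "solves V E T U f2 f3"
    unfolding solves_def using \<phi>(4,5) \<psi>(4,5) \<psi>3(3) by auto
  then show ?thesis by blast
qed

section \<open>Removing a root component\<close>

lemma root_step:
  fixes j :: "'b \<Rightarrow> 2"
  assumes adm: "admissible V E T U" and X: "X \<subseteq> V"
    and IH: "\<And>E' T' U'. admissible (V - X) E' T' U' \<Longrightarrow> \<exists>\<phi>2 \<phi>3. solves (V - X) E' T' U' \<phi>2 \<phi>3"
    and j: "\<And>v. v \<in> V \<Longrightarrow> bd E j v \<noteq> 0 \<longleftrightarrow> v \<in> T" "\<And>e. e \<in> cut E X \<Longrightarrow> j e = 0"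
    and con: "connected_by {e \<in> E. j e \<noteq> 0} X"
    and U: "card (X \<inter> U) \<ge> 2 \<or> U = {}"
  shows "\<exists>\<phi>2 \<phi>3. solves V E T U \<phi>2 \<phi>3"
proof -
  note A = admissibleD[OF adm]
  define C where "C = V - X"
  have cutC: "cut E C = cut E X" using A(3) X unfolding cut_def C_def by auto
  have CV: "C \<subseteq> V" unfolding C_def by auto
  have IHC: "\<exists>\<phi>2 \<phi>3. solves C E' T' U' \<phi>2 \<phi>3" if "admissible C E' T' U'" for E' T' U'
    using IH that unfolding C_def by auto
  have finX: "finite X" "finite C" using A(1) X finite_subset unfolding C_def by auto
  \<comment> \<open>Parity on the rest comes from \<open>j\<close>: edges leaving \<open>Z\<close>
    belong to the cut of \<open>X\<close>, where \<open>j\<close> is 0.\<close>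
  have ev: "even (card (T \<inter> Z))" if Z: "Z \<subseteq> C" "cut (inner E C) Z = {}" for Z
  proof (rule even_card_supp_bd)
    show "finite Z" using Z(1) finX finite_subset by auto
    show "j e = 0" if "e \<in> cut E Z" for e
    proof -
      have "e \<in> cut E X"
        using that Z A(3) unfolding cut_def inner_def C_def by blast
      then show ?thesis by (rule j(2))
    qed
    show "bd E j v \<noteq> 0 \<longleftrightarrow> v \<in> T" if "v \<in> Z" for v using that Z(1) j(1) C_def by auto
  qed
  obtain \<phi>2 :: "'b \<Rightarrow> 2" and \<phi>3 :: "'b \<Rightarrow> 3" where \<phi>:
    "\<And>e. e \<in> inner E C \<Longrightarrow> \<phi>2 e \<noteq> 0 \<or> \<phi>3 e \<noteq> 0"
    "\<And>e. e \<in> cut E X \<Longrightarrow> \<phi>2 e = 0" "\<And>e. e \<in> cut E X \<Longrightarrow> \<phi>3 e \<noteq> 0"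
    "\<And>v. v \<in> C \<Longrightarrow> bd E \<phi>2 v \<noteq> 0 \<longleftrightarrow> v \<in> T"
    "\<And>v. v \<in> C \<Longrightarrow> bd E \<phi>3 v \<noteq> 0 \<longleftrightarrow> v \<in> U"
    using extend_to_cut[OF adm CV ev IHC] unfolding cutC by blast
  define f2 where "f2 e = (if e \<in> inner E C then \<phi>2 e else j e)" for e
  \<comment> \<open>Inside \<open>X\<close>, the value 1 is final where \<open>j\<close> vanishes,
    and the value 0 on the support of \<open>j\<close> awaits the routed
    \<open>\<psi>\<close>.\<close>
  define f0 where "f0 e = (if e \<in> inner E X then (if j e = 0 then 1 else 0) else \<phi>3 e)" for e
  have f0: "bd E f0 v \<noteq> 0 \<longleftrightarrow> v \<in> U" if "v \<in> C" for v
  proof -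
    have "bd E f0 v = bd E \<phi>3 v"
      by (rule bd_cong) (use that in \<open>auto simp: f0_def inner_def C_def\<close>)
    then show ?thesis using \<phi>(5)[OF that] by simp
  qed
  define s where "s = (\<Sum>v\<in>X. bd E f0 v)"
  \<comment> \<open>Routing inside \<open>X\<close> preserves the total \<open>s\<close>, so the
    target \<open>\<tau>\<close> must have this sum. If \<open>U\<close> is empty, \<open>s\<close>
    is 0 because the totals over \<open>V\<close> and \<open>C\<close> are.\<close>
  have "\<exists>\<tau>. (\<forall>v\<in>X. \<tau> v \<noteq> 0 \<longleftrightarrow> v \<in> U) \<and> sum \<tau> X = s"
  proof (cases "U = {}")
    case True
    have "(\<Sum>v\<in>V. bd E f0 v) = 0"
      by (rule sum_bd_eq_0) (use A(1,3) in \<open>auto simp: cut_def\<close>)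
    moreover have "(\<Sum>v\<in>V. bd E f0 v) = s + (\<Sum>v\<in>C. bd E f0 v)"
      using X A(1) unfolding s_def C_def by (simp add: sum.subset_diff add.commute)
    moreover have "(\<Sum>v\<in>C. bd E f0 v) = 0"
      by (rule sum.neutral) (use f0 True in auto)
    ultimately show ?thesis using True by (intro exI[of _ "\<lambda>_. 0"]) simp
  next
    case False
    then have U2: "card (X \<inter> U) \<ge> 2" using U by simp
    then have "X \<inter> U \<noteq> {}" by auto
    then obtain \<chi> where \<chi>: "\<And>x. x \<in> X \<inter> U \<Longrightarrow> \<chi> x \<noteq> 0" "sum \<chi> (X \<inter> U) = s"
      using sum_nonzero3[of "X \<inter> U" s] finX U2 by auto
    have "(\<Sum>v\<in>X. if v \<in> U then \<chi> v else 0) = s"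
      using \<chi>(2) finX(1) by (simp add: sum.If_cases)
    then show ?thesis using \<chi>(1) by (intro exI[of _ "\<lambda>v. if v \<in> U then \<chi> v else 0"]) auto
  qed
  then obtain \<tau> where \<tau>: "\<And>v. v \<in> X \<Longrightarrow> \<tau> v \<noteq> 0 \<longleftrightarrow> v \<in> U" "sum \<tau> X = s" by auto
  have "(\<Sum>v\<in>X. \<tau> v - bd E f0 v) = 0" using \<tau>(2) unfolding s_def by (simp add: sum_subtractf)
  then obtain \<psi> where \<psi>: "\<And>e. e \<notin> inner {e \<in> E. j e \<noteq> 0} X \<Longrightarrow> \<psi> e = 0"
    "\<And>v. v \<in> X \<Longrightarrow> bd E \<psi> v = \<tau> v - bd E f0 v"
    using connected_by_route[OF finX(1) A(2) _ con, of "\<lambda>v. \<tau> v - bd E f0 v"] by auto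
  define f3 where "f3 e = f0 e + \<psi> e" for e
  have "solves V E T U f2 f3"
    unfolding solves_def
  proof (intro conjI ballI)
    fix e assume e: "e \<in> E"
    consider "e \<in> inner E C" "e \<notin> inner E X" | "e \<in> cut E X" "e \<notin> inner E X" | "e \<in> inner E X" "e \<notin> inner E C"
      using e A(3)[OF e] unfolding inner_def cut_def C_def by (cases "t e \<in> X"; cases "h e \<in> X") auto
    then show "f2 e \<noteq> 0 \<or> f3 e \<noteq> 0"
    proof cases
      case 1
      then show ?thesis using \<phi>(1) \<psi>(1)[of e] by (auto simp: f2_def f3_def f0_def inner_def)
    next
      case 2
      then show ?thesis using \<phi>(3) \<psi>(1)[of e] by (auto simp: f3_def f0_def inner_def)
    next
      case 3
      then show ?thesis using \<psi>(1)[of e] by (auto simp: f2_def f3_def f0_def inner_def)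
    qed
  next
    fix v assume v: "v \<in> V"
    have "bd E f2 v = (if v \<in> X then bd E j v else bd E \<phi>2 v)"
    proof -
      have "f2 e = j e" if "t e \<in> X \<or> h e \<in> X" for e
        using that unfolding f2_def inner_def C_def by auto
      moreover have "f2 e = \<phi>2 e" if "e \<in> E" "t e = v \<or> h e = v" "v \<notin> X" for e
      proof (cases "e \<in> inner E C")
        case False
        then have "e \<in> cut E X" using that A(3)[of e] v unfolding inner_def C_def cut_def by auto
        then show ?thesis using j(2) \<phi>(2) False unfolding f2_def by simp
      qed (simp add: f2_def)
      ultimately show ?thesis by (auto intro!: bd_cong)
    qed
    then show "bd E f2 v \<noteq> 0 \<longleftrightarrow> v \<in> T" using j(1) \<phi>(4) v C_def by auto
    have "bd E \<psi> v = bd E (\<lambda>_. 0) v" if "v \<notin> X"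
      by (rule bd_cong) (use \<psi>(1) that in \<open>auto simp: inner_def\<close>)
    then show "bd E f3 v \<noteq> 0 \<longleftrightarrow> v \<in> U"
      using \<psi>(2) \<tau>(1) f0 v unfolding f3_def bd_add C_def by (cases "v \<in> X") auto
  qed
  then show ?thesis by blast
qed

section \<open>Components and the induction\<close>

text \<open>The least set containing \<open>r\<close> that no edge of \<open>F\<close> leaves is
  connected: if it split into \<open>Y\<close> and \<open>X - Y\<close>, the part containing
  \<open>r\<close> would be smaller.\<close>

lemma component:
  assumes "\<And>e. e \<in> F \<Longrightarrow> t e \<in> V \<and> h e \<in> V" "r \<in> V"
  obtains X where "X \<subseteq> V" "r \<in> X" "cut F X = {}" "connected_by F X"
proof -
  define X where "X = \<Inter>{Z. Z \<subseteq> V \<and> r \<in> Z \<and> cut F Z = {}}"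
  have least: "X \<subseteq> Z" if "Z \<subseteq> V" "r \<in> Z" "cut F Z = {}" for Z using that unfolding X_def by auto
  have V: "X \<subseteq> V" using least[of V] assms by (auto simp: cut_def)
  have r: "r \<in> X" unfolding X_def by auto
  have X: "cut F X = {}" unfolding X_def cut_def by blast
  have "cut (inner F X) Y \<noteq> {}" if Y: "Y \<subseteq> X" "Y \<noteq> {}" "Y \<noteq> X" for Y
  proof
    assume "cut (inner F X) Y = {}"
    then have c: "cut F Y = {}" "cut F (X - Y) = {}"
      using X Y(1) unfolding cut_def inner_def by blast+
    show False
    proof (cases "r \<in> Y")
      case True
      then show False using least[OF _ _ c(1)] Y V by auto
    next
      case False
      then show False using least[OF _ _ c(2)] Y V r by auto
    qed
  qed
  then show ?thesis using that V r X unfolding connected_by_def by blast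
qed

lemma admissible_solvable:
  assumes "admissible V E T U"
  shows "\<exists>\<phi>2 \<phi>3. solves V E T U \<phi>2 \<phi>3"
  using assms
proof (induction "card V" arbitrary: V E T U rule: less_induct)
  case less
  note adm = less.prems
  note A = admissibleD[OF adm]
  have IH: "\<exists>\<phi>2 \<phi>3. solves C E' T' U' \<phi>2 \<phi>3" if "C \<subset> V" "admissible C E' T' U'" for C E' T' U'
    using less.hyps[of C] that psubset_card_mono[OF A(1)] by blast
  have inn: "inner E V = E" using A(3) by (auto simp: inner_def)
  have cutV: "cut E V = {}" using A(3) by (auto simp: cut_def)
  consider "V = {}" | "\<not> connected_by E V" | "V \<noteq> {}" "connected_by E V" by blast
  then show ?case
  proof cases
    case 1
    then have "E = {}" using A(3) by auto
    then have "solves V E T U (\<lambda>_. 0) (\<lambda>_. 0)" using 1 by (simp add: solves_def)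
    then show ?thesis by blast
  next
    case 2
    then obtain C where C: "C \<subseteq> V" "C \<noteq> {}" "C \<noteq> V" "cut E C = {}"
      unfolding connected_by_def inn by blast
    have D: "cut E (V - C) = {}" using C(4) A(3) unfolding cut_def by auto
    have cc: "cut E Z = cut (inner E Y) Z" if "Z \<subseteq> Y" "cut E Y = {}" for Y Z
      using that unfolding cut_def inner_def by blast
    show ?thesis
    proof (rule glue[OF adm C(1) _ _ IH IH])
      show "even (card (T \<inter> Z))" if "Z \<subseteq> C" "cut (inner E C) Z = {}" for Z
        using A(6)[of Z] cc[OF that(1) C(4)] that C(1) by auto
      show "even (card (T \<inter> Z))" if "Z \<subseteq> V - C" "cut (inner E (V - C)) Z = {}" for Z
        using A(6)[of Z] cc[OF that(1) D] that by auto
    qed (use C in auto)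
  next
    case 3
    show ?thesis
    proof (cases "U = {}")
      case True
      obtain r where r: "r \<in> V" using 3 by auto
      show ?thesis
        by (rule root_step[OF adm, of "{r}" "\<lambda>_. 0"])
          (use r A(4) True in \<open>auto intro: IH simp: connected_by_def subset_singleton_iff\<close>)
    next
      case False
      have finU: "finite U" using A(1,5) finite_subset by blast
      have "card U \<noteq> 1" using A(5) A(7)[OF subset_refl cutV] by (simp add: Int_absorb2)
      moreover have "card U \<noteq> 0" using False finU by simp
      ultimately have U2: "card U \<ge> 2" by linarith
      \<comment> \<open>It remains to find \<open>j\<close> and a root \<open>r\<close>; the
        component of \<open>r\<close> in the support of \<open>j\<close> is one of the sets to which
        \<open>two\<close> applies.\<close>
      have root: ?thesis
        if j: "\<And>v. v \<in> V \<Longrightarrow> bd E j v \<noteq> 0 \<longleftrightarrow> v \<in> T" and r: "r \<in> V"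
          and two: "\<And>X. X \<subseteq> V \<Longrightarrow> r \<in> X \<Longrightarrow> (\<And>e. e \<in> cut E X \<Longrightarrow> j e = 0) \<Longrightarrow> card (X \<inter> U) \<ge> 2"
        for j :: "'b \<Rightarrow> 2" and r
      proof -
        obtain X where X: "X \<subseteq> V" "r \<in> X" "cut {e \<in> E. j e \<noteq> 0} X = {}"
          "connected_by {e \<in> E. j e \<noteq> 0} X"
          using component[of "{e \<in> E. j e \<noteq> 0}" V r] A(3) r by auto
        have j0: "j e = 0" if "e \<in> cut E X" for e using X(3) that by (auto simp: cut_def)
        show ?thesis
          by (rule root_step[OF adm X(1) IH j j0 X(4)]) (use X two j0 in auto)
      qed
      show ?thesis
      proof (cases "T = {}")
        case False
        then obtain r where r: "r \<in> T" by auto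
        have "even (card T)" using A(4,5) A(6)[OF subset_refl cutV] by (simp add: Int_absorb2 subset_trans)
        then have "(\<Sum>v\<in>V. if v \<in> T then 1 else 0 :: 2) = 0"
          using A(1,4,5) by (simp add: sum.If_cases Int_absorb1 of_nat_2_eq_0_iff)
        then obtain j :: "'b \<Rightarrow> 2" where j: "\<And>v. v \<in> V \<Longrightarrow> bd E j v = (if v \<in> T then 1 else 0)"
          by (rule connected_by_route[OF A(1,2) subset_refl 3(2), of "\<lambda>v. if v \<in> T then 1 else 0"]) auto
        have jT: "bd E j v \<noteq> 0 \<longleftrightarrow> v \<in> T" if "v \<in> V" for v using j[OF that] by simp
        show ?thesis
        proof (rule root[of j r])
          fix X assume X: "X \<subseteq> V" "r \<in> X" "\<And>e. e \<in> cut E X \<Longrightarrow> j e = 0"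
          have fX: "finite X" using X(1) A(1) finite_subset by blast
          have "even (card (T \<inter> X))"
            by (rule even_card_supp_bd[OF fX X(3) jT[OF subsetD[OF X(1)]]])
          moreover have "card (T \<inter> X) \<noteq> 0" using r X(2) fX by auto
          ultimately have "card (T \<inter> X) \<ge> 2" by presburger
          also have "card (T \<inter> X) \<le> card (X \<inter> U)"
            using A(4) fX by (intro card_mono) auto
          finally show "card (X \<inter> U) \<ge> 2" .
        qed (use r A(4,5) jT in blast)+
      next
        case T: True
        show ?thesis
        proof (cases "\<exists>S\<subseteq>V. card (cut E S) = 1")
          case True
          then obtain S where S: "S \<subseteq> V" "card (cut E S) = 1" by auto
          then have "cut E S \<noteq> {}" by auto
          then have "S \<noteq> {}" "S \<noteq> V" using cutV by (auto simp: cut_def)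
          then show ?thesis
            using S T by (intro glue[OF adm S(1)] IH) auto
        next
          case False
          obtain u v where uv: "u \<in> U" "v \<in> U" "u \<noteq> v"
            using U2 finU by (metis card_le_Suc0_iff_eq not_less_eq_eq numeral_2_eq_2)
          obtain f :: "'b \<Rightarrow> int" where f: "\<And>e. f e \<in> {-1, 0, 1}"
            "\<And>x. bd E f x = (if x = u then 2 else 0) - (if x = v then 2 else 0)"
            using two_unit_flow[OF A(1,2) 3(2) A(3), of u v] uv A(5) False by blast
          show ?thesis
          proof (rule root[of "\<lambda>e. of_int (f e)" u])
            fix X assume X: "X \<subseteq> V" "u \<in> X" "\<And>e. e \<in> cut E X \<Longrightarrow> (of_int (f e) :: 2) = 0"
            have fX: "finite X" using X(1) A(1) finite_subset by blast
            \<comment> \<open>As \<open>f e\<close> is -1, 0 or 1, vanishing modulo 2 means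
              vanishing over the integers. Hence the two units starting at \<open>u\<close> cannot
              leave \<open>X\<close>, and \<open>v\<close> lies in it.\<close>
            have "f e = 0" if "e \<in> cut E X" for e
              using X(3)[OF that] f(1)[of e] by auto
            then have "(\<Sum>x\<in>X. bd E f x) = 0" using sum_bd_eq_0[OF fX] by blast
            then have "v \<in> X" using X(2) fX unfolding f(2) by (auto simp: sum_subtractf split: if_splits)
            then have "card {u, v} \<le> card (X \<inter> U)" using uv X(2) fX by (intro card_mono) auto
            then show "card (X \<inter> U) \<ge> 2" using uv(3) by simp
          qed (use uv A(5) T in \<open>auto simp: bd_of_int f(2)\<close>)
        qed
      qed
    qed
  qed
qed

end

section \<open>Transfer to digraphs\<close>

text \<open>A walk in the symmetrised digraph cannot leave a set with empty cut.\<close>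

lemma (in wf_digraph) connected_by_arcs:
  assumes "connected G"
  shows "endpoints.connected_by (tail G) (head G) (arcs G) (verts G)"
proof -
  interpret endpoints "tail G" "head G" .
  interpret S: pair_wf_digraph "mk_symmetric G" by (rule wellformed_mk_symmetric)
  have "cut (arcs G) Y \<noteq> {}" if Y: "Y \<subseteq> verts G" "Y \<noteq> {}" "Y \<noteq> verts G" for Y
  proof
    assume c: "cut (arcs G) Y = {}"
    obtain a b where ab: "a \<in> Y" "b \<in> verts G" "b \<notin> Y" using Y by auto
    have "a \<rightarrow>\<^sup>*\<^bsub>mk_symmetric G\<^esub> b"
      using assms ab Y unfolding connected_def strongly_connected_def by auto
    then have "b \<in> Y"
    proof (induction rule: S.reachable_induct)
      case (step x y)
      then obtain e where "e \<in> arcs G" "{tail G e, head G e} = {x, y}"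
        by (auto simp: mk_symmetric_def arcs_ends_conv parcs_mk_symmetric elim!: converseE)
      then show ?case using step.IH c by (auto simp: cut_def doubleton_eq_iff)
    qed (rule ab(1))
    then show False using ab(3) by simp
  qed
  moreover have "inner (arcs G) (verts G) = arcs G" by (auto simp: inner_def)
  ultimately show ?thesis unfolding connected_by_def by simp
qed

theorem theorem2:
  fixes G :: "('a, 'b) pre_digraph" and T U :: "'a set"
  assumes "fin_digraph G"
    and "Digraph_Component.connected G"
    and "T \<subseteq> U" and "U \<subseteq> verts G"
    and "even (card T)" and "card U \<noteq> 1"
    and "\<And>V'. V' \<noteq> {} \<Longrightarrow> V' \<subset> verts G \<Longrightarrow> V' \<inter> U = {} \<Longrightarrow> cut_size G V' \<ge> 2"
  shows "\<exists>(\<phi>2 :: 'b \<Rightarrow> 2) (\<phi>3 :: 'b \<Rightarrow> 3).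
    (\<forall>e \<in> arcs G. (\<phi>2 e, \<phi>3 e) \<noteq> (0, 0)) \<and>
    vsupp G (boundary G \<phi>2) = T \<and>
    vsupp G (boundary G \<phi>3) = U"
proof -
  interpret fin_digraph G by fact
  interpret endpoints "tail G" "head G" .
  have boundary: "boundary G \<phi> v = bd (arcs G) \<phi> v" for \<phi> :: "'b \<Rightarrow> 'c::ab_group_add" and v
    unfolding boundary_def bd_def sum_subtractf out_arcs_def in_arcs_def
    by (simp add: sum.If_cases Int_def)
  have cut_size: "cut_size G X = card (cut (arcs G) X)" for X
    unfolding cut_size_def cut_def ..
  \<comment> \<open>By connectedness, the conditions on unions of components reduce to the
    hypotheses on the sizes of \<open>T\<close> and \<open>U\<close>.\<close>
  have closed: "Z = {} \<or> Z = verts G" if "Z \<subseteq> verts G" "cut (arcs G) Z = {}" for Z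
  proof -
    have "inner (arcs G) (verts G) = arcs G" by (auto simp: inner_def)
    then show ?thesis
      using connected_by_arcs[OF assms(2)] that unfolding connected_by_def by auto
  qed
  have "admissible (verts G) (arcs G) T U"
    unfolding admissible_def
  proof (intro conjI allI impI)
    show "even (card (T \<inter> Z))" "card (U \<inter> Z) \<noteq> 1" if "Z \<subseteq> verts G" "cut (arcs G) Z = {}" for Z
      using closed[OF that] assms(3-6) by (auto simp: Int_absorb2 subset_trans[OF assms(3,4)])
    show "card (cut (arcs G) Z) \<noteq> 1" if Z: "Z \<subseteq> verts G" "Z \<inter> U = {}" for Z
    proof (cases "Z = {} \<or> Z = verts G")
      case True
      then have "cut (arcs G) Z = {}" by (auto simp: cut_def)
      then show ?thesis by simp
    next
      case False
      then have "Z \<noteq> {}" "Z \<subset> verts G" using Z by auto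
      then show ?thesis using assms(7)[of Z] Z(2) unfolding cut_size by auto
    qed
  qed (use assms(3,4) in auto)
  then obtain \<phi>2 :: "'b \<Rightarrow> 2" and \<phi>3 :: "'b \<Rightarrow> 3" where "solves (verts G) (arcs G) T U \<phi>2 \<phi>3"
    using admissible_solvable by blast
  then have "(\<forall>e \<in> arcs G. (\<phi>2 e, \<phi>3 e) \<noteq> (0, 0)) \<and>
    vsupp G (boundary G \<phi>2) = T \<and> vsupp G (boundary G \<phi>3) = U"
    using assms(3,4) unfolding solves_def vsupp_def boundary by auto
  then show ?thesis by blast
qed

end
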